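(* Let $C_0\in\mathcal C_\odot$ be an initial configuration. There exists no algorithm that solves \textsc{Move-All} in $2$ steps from $C_0$, even if the system has chirality.
   Context: Model. There are $n\ge 2$ robots $r_0,\dots,r_{n-1}$, which are points in $\mathbb R^2$. A configuration is a tuple $C=(p_0,\dots,p_{n-1})$ of points, $p_i$ being the position of $r_i$ in a fixed global coordinate system unknown to the robots; an initial configuration consists of pairwise distinct points. Each robot $r_i$ has a local Cartesian coordinate system $Z_i$, always centred at its current position, whose orientation and unit length are fixed over time but arbitrary and possibly different for different robots. Chirality: all $Z_i$ have the same handedness (the robots agree on the clockwise direction). Robots are anonymous, oblivious and deterministic: an algorithm $\mathcal A$ is one function, the same for all robots, mapping a snapshot (the multiset of positions of all robots expressed in the observing robot's local coordinate system, its own position being the origin) to a destination point (in the same local coordinates). In each round all robots simultaneously take a snapshot, compute their destination, and move exactly to it. Thus $C_0$ and $Z=(Z_0,\dots,Z_{n-1})$ determine the run $(C_0,C_1,C_2,\dots)$ of $\mathcal A$. Permutations. For a permutation $\pi$ of $\{0,\dots,n-1\}$ put $\pi(C)=(p_{\pi(0)},\dots,p_{\pi(n-1)})$. $\Pi_2$ is the set of permutations without fixed points. Problem. For $k\ge 1$, $\mathcal A$ solves \textsc{Move-All} in $k$ steps from $C_0$ if for every admissible $Z$ the run $(C_0,C_1,\dots)$ has the following property: for every $j\ge 0$ there is $\pi\in\Pi_2$ with $C_{j+ik}=\pi^i(C_j)$ for all $i\ge 0$. (As the robots are oblivious, every reached configuration $C_j$ counts as an initial configuration, from which the algorithm must also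 be correct.) $\mathcal C_\odot$ is the set of configurations $C$ having exactly one robot $r_c$ (the central robot) at the centre of the smallest circle enclosing $C$, and such that for some integer $k>1$ the rotation by $2\pi/k$ about the position of $r_c$ maps the multiset of points of $C$ to itself (so $n\ge 3$). *)

theory Defs
  imports
    "HOL-Combinatorics.Permutations"
    "HOL-Analysis.Analysis"
begin

text \<open>The plane is identified with the complex numbers. A configuration is the tuple of robot
  positions; robot \<open>r\<^sub>i\<close> is the index \<open>i\<close>.\<close>

type_synonym point = complex
type_synonym configuration = "point list"

datatype handedness = Right_Handed | Left_Handed

text \<open>\<open>x_axis\<close> is the angle of the local x-axis and \<open>unit_length\<close> the local unit length, both
  measured in the global system. The origin is not stored, since it moves with the robot.\<close>

datatype frame = Frame (x_axis: real) (unit_length: real) (handed: handedness)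

text \<open>In a left-handed system the local y-axis is the clockwise normal of the local x-axis,
  hence the conjugation.\<close>

definition to_local :: "frame \<Rightarrow> point \<Rightarrow> point \<Rightarrow> point" where
  "to_local Z orig p =
    (let q = cis (- x_axis Z) * (p - orig) / complex_of_real (unit_length Z)
     in case handed Z of Right_Handed \<Rightarrow> q | Left_Handed \<Rightarrow> cnj q)"

definition to_global :: "frame \<Rightarrow> point \<Rightarrow> point \<Rightarrow> point" where
  "to_global Z orig q =
    orig + complex_of_real (unit_length Z) * cis (x_axis Z) *
      (case handed Z of Right_Handed \<Rightarrow> q | Left_Handed \<Rightarrow> cnj q)"

lemma to_global_to_local:
  assumes "unit_length Z > 0"
  shows "to_global Z orig (to_local Z orig p) = p"
  using assms
  by (cases "handed Z")
     (simp_all add: to_global_def to_local_def Let_def cis_cnj mult.assoc [symmetric] cis_mult)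

lemma to_local_to_global:
  assumes "unit_length Z > 0"
  shows "to_local Z orig (to_global Z orig q) = q"
  using assms
  by (cases "handed Z")
     (simp_all add: to_global_def to_local_def Let_def cis_cnj mult.assoc [symmetric] cis_mult
        mult.commute [of "cis _" "complex_of_real _"])

definition admissible_frames :: "nat \<Rightarrow> frame list \<Rightarrow> bool" where
  "admissible_frames n Z \<longleftrightarrow>
     length Z = n \<and> (\<forall>i<n. unit_length (Z ! i) > 0) \<and>
     (\<forall>i<n. \<forall>j<n. handed (Z ! i) = handed (Z ! j))"

type_synonym algorithm = "point multiset \<Rightarrow> point"

definition snapshot :: "frame \<Rightarrow> point \<Rightarrow> configuration \<Rightarrow> point multiset" where
  "snapshot Z orig C = image_mset (to_local Z orig) (mset C)"

definition next_configuration ::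
  "algorithm \<Rightarrow> frame list \<Rightarrow> configuration \<Rightarrow> configuration" where
  "next_configuration \<A> Z C =
     map (\<lambda>i. to_global (Z ! i) (C ! i) (\<A> (snapshot (Z ! i) (C ! i) C))) [0..<length C]"

definition run :: "algorithm \<Rightarrow> frame list \<Rightarrow> configuration \<Rightarrow> nat \<Rightarrow> configuration" where
  "run \<A> Z C\<^sub>0 j = (next_configuration \<A> Z ^^ j) C\<^sub>0"

definition fixpoint_free_perms :: "nat \<Rightarrow> (nat \<Rightarrow> nat) set" where
  "fixpoint_free_perms n = {\<pi>. \<pi> permutes {..<n} \<and> (\<forall>i<n. \<pi> i \<noteq> i)}"

text \<open>\<open>permute_list \<pi> [p\<^sub>0, \<dots>]\<close> is \<open>[p\<^bsub>\<pi> 0\<^esub>, \<dots>]\<close>.\<close>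

definition solves_move_all :: "algorithm \<Rightarrow> nat \<Rightarrow> configuration \<Rightarrow> bool" where
  "solves_move_all \<A> k C\<^sub>0 \<longleftrightarrow>
     (\<forall>Z. admissible_frames (length C\<^sub>0) Z \<longrightarrow>
        (\<forall>j. \<exists>\<pi>\<in>fixpoint_free_perms (length C\<^sub>0). \<forall>i.
           run \<A> Z C\<^sub>0 (j + i * k) = permute_list (\<pi> ^^ i) (run \<A> Z C\<^sub>0 j)))"

definition smallest_enclosing_circle :: "point set \<Rightarrow> point \<Rightarrow> real \<Rightarrow> bool" where
  "smallest_enclosing_circle S c r \<longleftrightarrow>
     S \<subseteq> cball c r \<and> (\<forall>c' r'. S \<subseteq> cball c' r' \<longrightarrow> r \<le> r')"

definition rotate_about :: "point \<Rightarrow> real \<Rightarrow> point \<Rightarrow> point" where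
  "rotate_about c \<theta> p = c + cis \<theta> * (p - c)"

definition C_odot :: "configuration set" where
  "C_odot = {C. \<exists>c r. smallest_enclosing_circle (set C) c r \<and>
     (\<exists>!i. i < length C \<and> C ! i = c) \<and>
     (\<exists>k::nat. k > 1 \<and> image_mset (rotate_about c (2 * pi / real k)) (mset C) = mset C)}"

end

theory Submission
  imports Defs
begin

text \<open>Let \<open>\<rho>\<close> be the rotation that preserves the configuration \<open>C\<^sub>0\<close>, and let \<open>G\<close> be a fixed
  frame of the central robot.

  Suppose the central robot stays when its frame is \<open>G\<close>. Give the other robots frames that are
  permuted by \<open>\<rho>\<close>. Then the next configuration is still invariant under \<open>\<rho>\<close> about the central
  robot, so replacing \<open>G\<close> by \<open>\<rho>G\<close> changes the second move of the central robot from \<open>w\<close> to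
  \<open>\<rho>w\<close> and nothing else. Both outcomes must be the point set of \<open>C\<^sub>0\<close>, hence \<open>w = \<rho>w\<close> is the
  centre, but the central robot must have moved.

  Suppose it moves to \<open>v\<close>, and hence to \<open>\<rho>v \<noteq> v\<close> under the frame \<open>\<rho>G\<close>. Two robots that have the
  same frame and move to the same point can never be separated again, so under \<open>G\<close> the
  destinations of the points of \<open>C\<^sub>0\<close> are pairwise distinct. Give the frame \<open>\<rho>G\<close> to the central
  robot and \<open>G\<close> to all others. After two rounds the points are those of \<open>C\<^sub>0\<close>, but the only robot
  with frame \<open>\<rho>G\<close> is now at a noncentral point \<open>q\<close>. As the third configuration has the same
  points as the first, \<open>\<rho>v\<close> and the destination of \<open>q\<close> under \<open>G\<close> are, in some order, the
  destination of \<open>q\<close> under \<open>\<rho>G\<close> and \<open>v\<close>. So \<open>q\<close> and the centre both go to \<open>v\<close> under \<open>G\<close>, a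
  contradiction.\<close>

definition move :: "algorithm \<Rightarrow> frame \<Rightarrow> point multiset \<Rightarrow> point \<Rightarrow> point" where
  "move \<A> H S p = to_global H p (\<A> (image_mset (to_local H p) S))"

lemma next_configuration_move:
  "next_configuration \<A> Z C = map (\<lambda>i. move \<A> (Z ! i) (mset C) (C ! i)) [0..<length C]"
  by (simp add: next_configuration_def move_def snapshot_def)

lemma length_next_configuration [simp]: "length (next_configuration \<A> Z C) = length C"
  by (simp add: next_configuration_def)

lemma nth_next_configuration:
  "i < length C \<Longrightarrow> next_configuration \<A> Z C ! i = move \<A> (Z ! i) (mset C) (C ! i)"
  by (simp add: next_configuration_move)

lemma rotate_about_diff:
  "rotate_about c t q - rotate_about c t p = cis t * (q - p)"
  by (simp add: rotate_about_def algebra_simps)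

lemma rotate_about_centre [simp]: "rotate_about c t c = c"
  by (simp add: rotate_about_def)

lemma rotate_about_fixed_iff:
  assumes "cis t \<noteq> 1"
  shows "rotate_about c t p = p \<longleftrightarrow> p = c"
proof
  assume "rotate_about c t p = p"
  then have "(cis t - 1) * (p - c) = 0"
    by (simp add: rotate_about_def algebra_simps)
  with assms show "p = c" by simp
qed simp

lemma cis_two_pi_div_neq_1:
  fixes k :: nat
  assumes "k > 1"
  shows "cis (2 * pi / real k) \<noteq> 1"
proof
  assume "cis (2 * pi / real k) = 1"
  then have "cos (2 * pi / real k) = 1"
    by (metis cis.simps(1) one_complex.simps(1))
  then obtain m :: int where "2 * pi / real k = of_int m * 2 * pi"
    by (auto simp: cos_one_2pi_int)
  then have "real_of_int m * real k = 1"
    using assms by (simp add: field_simps)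
  then have "m * int k = 1"
    by (metis of_int_1 of_int_eq_iff of_int_mult of_int_of_nat_eq)
  then have "int k dvd 1"
    by (metis dvd_triv_right)
  with assms show False by simp
qed

text \<open>The turned frame at the turned point sees the turned set as the old frame sees the old
  one; since \<open>S\<close> is invariant, both snapshots coincide. Axes are compared through
  \<open>cis\<close> because angles matter only modulo \<open>2 * pi\<close>.\<close>

lemma move_rotate_about:
  assumes frames: "unit_length H' = unit_length H" "handed H' = handed H"
      "cis (x_axis H') = cis t * cis (x_axis H)"
    and sym: "image_mset (rotate_about c t) S = S"
  shows "move \<A> H' S (rotate_about c t p) = rotate_about c t (move \<A> H S p)"
proof -
  have "cis (- x_axis H') = cis (- x_axis H) * cis (- t)"
    by (metis frames(3) cis_cnj complex_cnj_mult mult.commute)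
  then have "cis (- x_axis H') * cis t = cis (- x_axis H)"
    by (simp add: mult.assoc cis_mult)
  then have "cis (- x_axis H') * (cis t * (q - p)) = cis (- x_axis H) * (q - p)" for q
    by (simp flip: mult.assoc)
  then have local: "to_local H' (rotate_about c t p) (rotate_about c t q) = to_local H p q" for q
    by (simp only: to_local_def rotate_about_diff frames(1,2))
  have "image_mset (to_local H' (rotate_about c t p)) S
      = image_mset (to_local H' (rotate_about c t p)) (image_mset (rotate_about c t) S)"
    by (simp only: sym)
  also have "\<dots> = image_mset (to_local H p) S"
    by (simp add: multiset.map_comp comp_def local)
  finally show ?thesis
    by (simp add: move_def to_global_def rotate_about_def frames algebra_simps
        split: handedness.split)
qed

text \<open>Isolates the effect of giving a single robot another frame; adding the other side's
  entry at \<open>m\<close> to each side avoids multiset differences.\<close>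

lemma mset_map_change_one:
  assumes "m < n" and "\<And>i. i < n \<Longrightarrow> i \<noteq> m \<Longrightarrow> f i = g i"
  shows "add_mset (g m) (mset (map f [0..<n])) = add_mset (f m) (mset (map g [0..<n]))"
proof -
  have split: "mset [0..<n] = add_mset m (mset [0..<n] - {#m#})"
    using assms(1) by simp
  have "image_mset f (mset [0..<n] - {#m#}) = image_mset g (mset [0..<n] - {#m#})"
  proof (rule image_mset_cong)
    fix i assume "i \<in># mset [0..<n] - {#m#}"
    then have "i \<in> set (remove1 m [0..<n])"
      by (metis mset_remove1 set_mset_mset)
    then have "i < n" "i \<noteq> m"
      by simp_all
    then show "f i = g i" using assms(2) by simp
  qed
  then show ?thesis
    unfolding mset_map by (subst (1 2) split) simp
qed

locale move_all_two_steps =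
  fixes \<A> :: algorithm and C :: configuration and m :: nat and t :: real
  assumes solves: "solves_move_all \<A> 2 C"
    and distinct: "distinct C"
    and m: "m < length C"
    and sym: "image_mset (rotate_about (C ! m) t) (mset C) = mset C"
    and t: "cis t \<noteq> 1"
begin

lemma two_steps:
  assumes "admissible_frames (length C) Z"
  obtains \<pi> where "\<pi> permutes {..<length C}" "\<And>i. i < length C \<Longrightarrow> \<pi> i \<noteq> i"
    "run \<A> Z C (j + 2) = permute_list \<pi> (run \<A> Z C j)"
proof -
  obtain \<pi> where "\<pi> \<in> fixpoint_free_perms (length C)"
    "\<And>i. run \<A> Z C (j + i * 2) = permute_list (\<pi> ^^ i) (run \<A> Z C j)"
    using solves assms unfolding solves_move_all_def by blast
  from this(1) this(2) [of 1] that show thesis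
    by (auto simp: fixpoint_free_perms_def)
qed

lemma second_configuration:
  assumes "admissible_frames (length C) Z"
  obtains \<pi> where "\<pi> permutes {..<length C}" "\<And>i. i < length C \<Longrightarrow> \<pi> i \<noteq> i"
    "next_configuration \<A> Z (next_configuration \<A> Z C) = permute_list \<pi> C"
  using two_steps [OF assms, of 0] by (auto simp: run_def numeral_2_eq_2)

lemma central_robot_moves: "move \<A> (Frame 0 1 Right_Handed) (mset C) (C ! m) \<noteq> C ! m"
proof
  assume stays: "move \<A> (Frame 0 1 Right_Handed) (mset C) (C ! m) = C ! m"
  let ?c = "C ! m" and ?n = "length C"
  let ?\<rho> = "rotate_about ?c t"
  \<comment> \<open>Since \<open>Arg 0 = 0\<close>, the central robot gets \<open>Frame 0 1 Right_Handed\<close>.\<close>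
  define F where "F p = Frame (Arg (p - ?c)) 1 Right_Handed" for p
  define Z where "Z = map F C"
  define Z' where "Z' = Z[m := Frame t 1 Right_Handed]"
  define \<phi> where "\<phi> p = move \<A> (F p) (mset C) p" for p
  define C1 where "C1 = map \<phi> C"
  have adm: "admissible_frames ?n Z" "admissible_frames ?n Z'"
    using m by (auto simp: admissible_frames_def Z_def Z'_def F_def nth_list_update)
  have \<phi>_c: "\<phi> ?c = ?c"
    using stays by (simp add: \<phi>_def F_def Arg_zero)
  have stays': "move \<A> (Frame t 1 Right_Handed) (mset C) ?c = ?c"
    using move_rotate_about [of "Frame t 1 Right_Handed" "Frame 0 1 Right_Handed" t ?c "mset C" \<A> ?c]
      sym stays by simp
  \<comment> \<open>Off the centre, the x-axis of \<open>F p\<close> points radially outwards, so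
    the rotation turns it along with \<open>p\<close>.\<close>
  have \<phi>_rho: "\<phi> (?\<rho> p) = ?\<rho> (\<phi> p)" for p
  proof (cases "p = ?c")
    case True
    then show ?thesis by (simp add: \<phi>_c)
  next
    case False
    have "cis (x_axis (F (?\<rho> p))) = cis t * cis (x_axis (F p))"
      using False by (simp add: F_def rotate_about_def cis_Arg sgn_eq norm_mult)
    then show ?thesis
      unfolding \<phi>_def by (intro move_rotate_about sym) (simp_all add: F_def)
  qed
  have len1 [simp]: "length C1 = ?n" by (simp add: C1_def)
  have C1_m: "C1 ! m = ?c" using m by (simp add: C1_def \<phi>_c)
  have sym1: "image_mset ?\<rho> (mset C1) = mset C1"
  proof -
    have "image_mset ?\<rho> (mset C1) = image_mset \<phi> (image_mset ?\<rho> (mset C))"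
      by (simp add: C1_def multiset.map_comp comp_def \<phi>_rho)
    then show ?thesis by (simp add: sym C1_def)
  qed
  have N: "next_configuration \<A> Z C = C1"
    by (rule nth_equalityI) (simp_all add: nth_next_configuration C1_def Z_def \<phi>_def)
  have N': "next_configuration \<A> Z' C = C1"
  proof (rule nth_equalityI)
    fix i assume "i < length (next_configuration \<A> Z' C)"
    then show "next_configuration \<A> Z' C ! i = C1 ! i"
      using stays' C1_m
      by (cases "i = m") (simp_all add: nth_next_configuration C1_def Z'_def Z_def \<phi>_def)
  qed simp
  let ?f = "\<lambda>i. move \<A> (Z ! i) (mset C1) (C1 ! i)"
  let ?f' = "\<lambda>i. move \<A> (Z' ! i) (mset C1) (C1 ! i)"
  obtain \<pi> where \<pi>: "\<pi> permutes {..<?n}" "\<And>i. i < ?n \<Longrightarrow> \<pi> i \<noteq> i"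
    "next_configuration \<A> Z C1 = permute_list \<pi> C"
    using second_configuration [OF adm(1)] unfolding N by blast
  obtain \<pi>' where \<pi>': "\<pi>' permutes {..<?n}"
    "next_configuration \<A> Z' C1 = permute_list \<pi>' C"
    using second_configuration [OF adm(2)] unfolding N' by blast
  have "mset (map ?f [0..<?n]) = mset C"
    using \<pi>(3) mset_permute_list [OF \<pi>(1)] by (simp add: next_configuration_move)
  moreover have "mset (map ?f' [0..<?n]) = mset C"
    using \<pi>'(2) mset_permute_list [OF \<pi>'(1)] by (simp add: next_configuration_move)
  moreover have "add_mset (?f' m) (mset (map ?f [0..<?n]))
      = add_mset (?f m) (mset (map ?f' [0..<?n]))"
    using m by (intro mset_map_change_one) (simp_all add: Z'_def)
  \<comment> \<open>Equal multisets with equal entries away from \<open>m\<close> leave equal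
    entries at \<open>m\<close>.\<close>
  ultimately have "?f' m = ?f m" by simp
  moreover have "?f' m = ?\<rho> (?f m)"
    using move_rotate_about [of "Frame t 1 Right_Handed" "Z ! m" t ?c "mset C1" \<A> ?c]
      sym1 m by (simp add: C1_m Z'_def Z_def F_def Arg_zero)
  ultimately have "?f m = ?c"
    using rotate_about_fixed_iff [OF t] by simp
  moreover have "?f m = C ! \<pi> m"
    using arg_cong [OF \<pi>(3), of "\<lambda>xs. xs ! m"] m \<pi>(1)
    by (simp add: nth_next_configuration permute_list_nth)
  moreover have "\<pi> m < ?n"
    using permutes_in_image [OF \<pi>(1), of m] m by simp
  ultimately show False
    using distinct m \<pi>(2) [OF m] by (simp add: nth_eq_iff_index_eq)
qed

text \<open>If all robots use \<open>G\<close>, two that meet after one round get the same snapshot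
  and stay together, whereas the second configuration permutes the distinct points of
  \<open>C\<close>.\<close>

lemma inj_on_move:
  assumes "unit_length G > 0"
  shows "inj_on (move \<A> G (mset C)) (set C)"
proof (rule inj_onI)
  fix p q
  assume "p \<in> set C" "q \<in> set C" and eq: "move \<A> G (mset C) p = move \<A> G (mset C) q"
  then obtain i j where ij: "i < length C" "j < length C" "p = C ! i" "q = C ! j"
    by (metis in_set_conv_nth)
  define Z where "Z = replicate (length C) G"
  have "admissible_frames (length C) Z"
    using assms by (simp add: admissible_frames_def Z_def)
  then obtain \<pi> where \<pi>: "\<pi> permutes {..<length C}"
    "next_configuration \<A> Z (next_configuration \<A> Z C) = permute_list \<pi> C"
    using second_configuration by blast
  have "next_configuration \<A> Z C ! i = next_configuration \<A> Z C ! j"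
    using ij eq by (simp add: nth_next_configuration Z_def)
  then have "permute_list \<pi> C ! i = permute_list \<pi> C ! j"
    using ij by (simp add: nth_next_configuration Z_def flip: \<pi>(2))
  moreover have "distinct (permute_list \<pi> C)"
    using distinct_permute_list [OF \<pi>(1)] distinct by simp
  ultimately have "i = j"
    using ij by (simp add: nth_eq_iff_index_eq)
  then show "p = q" using ij by simp
qed

lemma contradiction: False
proof -
  let ?n = "length C" and ?c = "C ! m"
  define G where "G = Frame 0 1 Right_Handed"
  define G' where "G' = Frame t 1 Right_Handed"
  define h where "h = move \<A> G (mset C)"
  define h' where "h' = move \<A> G' (mset C)"
  define Z where "Z = (replicate ?n G)[m := G']"
  define C1 where "C1 = next_configuration \<A> Z C"
  have adm: "admissible_frames ?n Z"
    using m by (auto simp: admissible_frames_def Z_def G_def G'_def nth_list_update)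
  obtain \<pi> where \<pi>: "\<pi> permutes {..<?n}" "\<And>i. i < ?n \<Longrightarrow> \<pi> i \<noteq> i"
    and C2: "next_configuration \<A> Z C1 = permute_list \<pi> C"
    using second_configuration [OF adm] unfolding C1_def by blast
  \<comment> \<open>Periodicity counted from the first configuration instead of \<open>C\<close>:
    the third configuration permutes \<open>C1\<close>.\<close>
  obtain \<pi>' where \<pi>': "\<pi>' permutes {..<?n}"
    and "run \<A> Z C (1 + 2) = permute_list \<pi>' (run \<A> Z C 1)"
    using two_steps [OF adm] by blast
  then have C3: "next_configuration \<A> Z (permute_list \<pi> C) = permute_list \<pi>' C1"
    by (simp add: run_def numeral_3_eq_3 C1_def flip: C2)
  have len1 [simp]: "length C1 = ?n" by (simp add: C1_def)
  have \<pi>m: "\<pi> m < ?n"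
    using permutes_in_image [OF \<pi>(1), of m] m by simp
  \<comment> \<open>Serves for the first round, \<open>D = C\<close>, and the third,
    \<open>D = permute_list \<pi> C\<close>: all robots but \<open>m\<close> use \<open>G\<close>,
    wherever they stand.\<close>
  have destinations: "add_mset (h (D ! m)) (mset (next_configuration \<A> Z D))
      = add_mset (h' (D ! m)) (image_mset h (mset C))"
    if D: "mset D = mset C" for D
  proof -
    have [simp]: "length D = ?n" using D by (metis size_mset)
    have "map (\<lambda>i. h (D ! i)) [0..<?n] = map h D"
      by (rule nth_equalityI) simp_all
    moreover have "add_mset (h (D ! m)) (mset (next_configuration \<A> Z D))
        = add_mset (move \<A> (Z ! m) (mset D) (D ! m)) (mset (map (\<lambda>i. h (D ! i)) [0..<?n]))"
      unfolding next_configuration_move \<open>length D = ?n\<close>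
      by (rule mset_map_change_one) (use m in \<open>simp_all add: Z_def h_def D\<close>)
    ultimately show ?thesis
      using m by (simp add: D Z_def h'_def)
  qed
  have "mset (next_configuration \<A> Z (permute_list \<pi> C)) = mset C1"
    unfolding C3 using mset_permute_list [of \<pi>' C1] \<pi>' by simp
  with destinations [of "permute_list \<pi> C"]
  have "add_mset (h (C ! \<pi> m)) (mset C1) = add_mset (h' (C ! \<pi> m)) (image_mset h (mset C))"
    using mset_permute_list [OF \<pi>(1)] m \<pi>(1) by (simp add: permute_list_nth)
  moreover have "add_mset (h ?c) (mset C1) = add_mset (h' ?c) (image_mset h (mset C))"
    using destinations [of C] by (simp add: C1_def)
  ultimately have "add_mset (h' ?c) (add_mset (h (C ! \<pi> m)) (mset C1))
      = add_mset (h' (C ! \<pi> m)) (add_mset (h ?c) (mset C1))"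
    by (simp only: add_mset_commute)
  then have "{#h' ?c, h (C ! \<pi> m)#} + mset C1 = {#h' (C ! \<pi> m), h ?c#} + mset C1"
    by simp
  then have "{#h' ?c, h (C ! \<pi> m)#} = {#h' (C ! \<pi> m), h ?c#}"
    by (simp only: add_right_cancel)
  moreover have "h' ?c \<noteq> h ?c"
  proof -
    have "h' ?c = rotate_about ?c t (h ?c)"
      using move_rotate_about [of G' G t ?c "mset C" \<A> ?c] sym
      by (simp add: h_def h'_def G_def G'_def)
    then show ?thesis
      using rotate_about_fixed_iff [OF t] central_robot_moves by (simp add: h_def G_def)
  qed
  \<comment> \<open>As \<open>h' ?c\<close> differs from \<open>h ?c\<close>, it pairs with
    \<open>h' (C ! \<pi> m)\<close>, and the remaining two entries agree.\<close>
  ultimately have "h (C ! \<pi> m) = h ?c"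
    by (auto simp: add_eq_conv_ex)
  then have "C ! \<pi> m = ?c"
    using inj_on_move [of G] m \<pi>m unfolding h_def G_def by (simp add: inj_on_eq_iff)
  then show False
    using distinct m \<pi>m \<pi>(2) [OF m] by (simp add: nth_eq_iff_index_eq)
qed

end

theorem theorem4:
  fixes n :: nat and C\<^sub>0 :: configuration
  assumes "n \<ge> 2" and "length C\<^sub>0 = n" and "distinct C\<^sub>0" and "C\<^sub>0 \<in> C_odot"
  shows "\<not> (\<exists>\<A> :: algorithm. solves_move_all \<A> 2 C\<^sub>0)"
proof
  assume "\<exists>\<A> :: algorithm. solves_move_all \<A> 2 C\<^sub>0"
  then obtain \<A> :: algorithm where "solves_move_all \<A> 2 C\<^sub>0" ..
  moreover obtain m and k :: nat where "m < length C\<^sub>0" "k > 1"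
    "image_mset (rotate_about (C\<^sub>0 ! m) (2 * pi / real k)) (mset C\<^sub>0) = mset C\<^sub>0"
    using assms(4) unfolding C_odot_def by blast
  ultimately have "move_all_two_steps \<A> C\<^sub>0 m (2 * pi / real k)"
    using assms(3) by unfold_locales (simp_all add: cis_two_pi_div_neq_1)
  then show False by (rule move_all_two_steps.contradiction)
qed

end
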